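(* Let $\mu_1,k_1,m_1,\mu_2,k_2,m_2$ be positive integers with $m_i\ge k_i$ for $i=1,2$. If there exists a $(\mu_i,k_i,m_i)$ Latin trade for $i=1$ and for $i=2$, then there exists a $(\mu_1\mu_2,\,k_1k_2,\,m_1m_2)$ Latin trade.
   Context: A partial Latin square is a square array, some of whose cells are filled with symbols from a finite set and the others empty, such that each symbol occurs at most once in each row and at most once in each column. For a positive integer $\mu$, a $\mu$-way Latin trade is a tuple $(T_1,\dots,T_\mu)$ of partial Latin squares with exactly the same set of filled cells such that: every filled cell $(i,j)$ contains pairwise different entries in $T_1,\dots,T_\mu$; for each row $i$, the set of symbols in row $i$ is the same in all of $T_1,\dots,T_\mu$; and for each column $j$, the set of symbols in column $j$ is the same in all of $T_1,\dots,T_\mu$. For $\mu\le k\le m$, a $(\mu,k,m)$ Latin trade (also called a $\mu$-way $k$-homogeneous Latin trade) is a $\mu$-way Latin trade $(T_1,\dots,T_\mu)$ consisting of $m\times m$ arrays on a set of $m$ symbols such that in each $T_r$ every row has exactly $k$ filled cells, every column has exactly $k$ filled cells, and every symbol appears exactly $k$ times. *)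

theory Defs
  imports Main
begin

text \<open>
  An array is a function \<open>P\<close> from row and column indices to \<open>'s option\<close>; \<open>None\<close> marks an
  empty cell.  An \<open>n \<times> n\<close> array has its cells in \<open>{..<n} \<times> {..<n}\<close> and is \<open>None\<close> elsewhere,
  so that notions such as the set of filled cells need not mention \<open>n\<close>.
\<close>

type_synonym 's parray = "nat \<Rightarrow> nat \<Rightarrow> 's option"

definition filled_cells :: "'s parray \<Rightarrow> (nat \<times> nat) set" where
  "filled_cells P = {(i, j). P i j \<noteq> None}"

definition row_symbols :: "'s parray \<Rightarrow> nat \<Rightarrow> 's set" where
  "row_symbols P i = {s. \<exists>j. P i j = Some s}"

definition col_symbols :: "'s parray \<Rightarrow> nat \<Rightarrow> 's set" where
  "col_symbols P j = {s. \<exists>i. P i j = Some s}"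

definition partial_latin_square :: "nat \<Rightarrow> 's set \<Rightarrow> 's parray \<Rightarrow> bool" where
  "partial_latin_square n S P \<longleftrightarrow>
     finite S \<and>
     filled_cells P \<subseteq> {..<n} \<times> {..<n} \<and>
     (\<forall>i j s. P i j = Some s \<longrightarrow> s \<in> S) \<and>
     (\<forall>i j j' s. P i j = Some s \<and> P i j' = Some s \<longrightarrow> j = j') \<and>
     (\<forall>i i' j s. P i j = Some s \<and> P i' j = Some s \<longrightarrow> i = i')"

definition latin_trade :: "nat \<Rightarrow> nat \<Rightarrow> 's set \<Rightarrow> 's parray list \<Rightarrow> bool" where
  "latin_trade \<mu> n S T \<longleftrightarrow>
     \<mu> > 0 \<and> length T = \<mu> \<and>
     (\<forall>r<\<mu>. partial_latin_square n S (T ! r)) \<and>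
     (\<forall>r<\<mu>. \<forall>r'<\<mu>. filled_cells (T ! r) = filled_cells (T ! r')) \<and>
     (\<forall>r<\<mu>. \<forall>r'<\<mu>. r \<noteq> r' \<longrightarrow>
        (\<forall>(i, j) \<in> filled_cells (T ! r). (T ! r) i j \<noteq> (T ! r') i j)) \<and>
     (\<forall>r<\<mu>. \<forall>r'<\<mu>. \<forall>i. row_symbols (T ! r) i = row_symbols (T ! r') i) \<and>
     (\<forall>r<\<mu>. \<forall>r'<\<mu>. \<forall>j. col_symbols (T ! r) j = col_symbols (T ! r') j)"

definition homogeneous_latin_trade ::
    "nat \<Rightarrow> nat \<Rightarrow> nat \<Rightarrow> 's set \<Rightarrow> 's parray list \<Rightarrow> bool" where
  "homogeneous_latin_trade \<mu> k m S T \<longleftrightarrow>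
     \<mu> \<le> k \<and> k \<le> m \<and> card S = m \<and>
     latin_trade \<mu> m S T \<and>
     (\<forall>r<\<mu>.
        (\<forall>i<m. card {j. (i, j) \<in> filled_cells (T ! r)} = k) \<and>
        (\<forall>j<m. card {i. (i, j) \<in> filled_cells (T ! r)} = k) \<and>
        (\<forall>s\<in>S. card {(i, j). (T ! r) i j = Some s} = k))"

end

theory Submission
  imports Defs
begin

text \<open>
  The trade is a direct product.  Replace each cell of an array \<open>P\<close> by an \<open>n \<times> n\<close> block
  that is a copy of \<open>Q\<close>, with each symbol \<open>b\<close> of \<open>Q\<close> paired with the entry of \<open>P\<close> in the
  cell replaced (a block of an empty cell is empty).  Row \<open>I\<close> of the product is determined by the
  row \<open>I div n\<close> of \<open>P\<close> and the row \<open>I mod n\<close> of \<open>Q\<close>, and likewise for columns.  Hence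
  a cell is filled exactly when both of its coordinate cells are, and the symbols of a line form the
  Cartesian product of the symbols of the two coordinate lines (\<open>row_symbols_product\<close>,
  \<open>col_symbols_product\<close>).  The set of filled cells, and the symbol sets of the lines, are thus the
  same for all products of a member of the first trade with a member of the second.  Two
  different such products differ in one of the factors, so the pairs that they have in a
  common filled cell differ in that coordinate.  All three counts of homogeneity
  multiply: quotient and remainder by \<open>n\<close> identify the filled cells of a line with pairs of filled
  cells of the two coordinate lines, and the occurrences of \<open>(a, b)\<close> with pairs of an occurrence of
  \<open>a\<close> and one of \<open>b\<close> (\<open>card_div_mod\<close>, \<open>card_div_mod_cells\<close>).

  The symbols obtained are pairs.  A trade may be relabelled by any map that is injective on its
  symbols, and a finite set injects into the natural numbers; this gives the form asked for.
\<close>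

section \<open>Consequences of the definitions\<close>

lemma partial_latin_squareD:
  assumes "partial_latin_square n S P"
  shows "finite S"
    and "filled_cells P \<subseteq> {..<n} \<times> {..<n}"
    and "P i j = Some s \<Longrightarrow> s \<in> S"
    and "P i j = Some s \<Longrightarrow> P i j' = Some s \<Longrightarrow> j = j'"
    and "P i j = Some s \<Longrightarrow> P i' j = Some s \<Longrightarrow> i = i'"
  using assms unfolding partial_latin_square_def by simp_all blast+

lemma latin_tradeD:
  assumes "latin_trade \<mu> n S T"
  shows "\<mu> > 0" and "length T = \<mu>"
    and "r < \<mu> \<Longrightarrow> partial_latin_square n S (T ! r)"
    and "r < \<mu> \<Longrightarrow> r' < \<mu> \<Longrightarrow> filled_cells (T ! r) = filled_cells (T ! r')"
    and "r < \<mu> \<Longrightarrow> r' < \<mu> \<Longrightarrow> (i, j) \<in> filled_cells (T ! r) \<Longrightarrow>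
      (T ! r) i j = (T ! r') i j \<Longrightarrow> r = r'"
    and "r < \<mu> \<Longrightarrow> r' < \<mu> \<Longrightarrow> row_symbols (T ! r) i = row_symbols (T ! r') i"
    and "r < \<mu> \<Longrightarrow> r' < \<mu> \<Longrightarrow> col_symbols (T ! r) j = col_symbols (T ! r') j"
proof -
  note T = assms[unfolded latin_trade_def]
  note T' = T[THEN conjunct2, THEN conjunct2]
  note T'' = T'[THEN conjunct2, THEN conjunct2]
  show "\<mu> > 0" and "length T = \<mu>"
    by (simp_all only: T)
  show "r < \<mu> \<Longrightarrow> partial_latin_square n S (T ! r)"
    by (rule T'[THEN conjunct1, rule_format])
  show "r < \<mu> \<Longrightarrow> r' < \<mu> \<Longrightarrow> filled_cells (T ! r) = filled_cells (T ! r')"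
    by (rule T'[THEN conjunct2, THEN conjunct1, rule_format])
  show "r < \<mu> \<Longrightarrow> r' < \<mu> \<Longrightarrow> (i, j) \<in> filled_cells (T ! r) \<Longrightarrow>
      (T ! r) i j = (T ! r') i j \<Longrightarrow> r = r'"
    using T''[THEN conjunct1] by blast
  show "r < \<mu> \<Longrightarrow> r' < \<mu> \<Longrightarrow> row_symbols (T ! r) i = row_symbols (T ! r') i"
    by (rule T''[THEN conjunct2, THEN conjunct1, rule_format])
  show "r < \<mu> \<Longrightarrow> r' < \<mu> \<Longrightarrow> col_symbols (T ! r) j = col_symbols (T ! r') j"
    by (rule T''[THEN conjunct2, THEN conjunct2, rule_format])
qed

lemma latin_tradeI:
  assumes "\<mu> > 0" and "length T = \<mu>"
    and "\<And>r. r < \<mu> \<Longrightarrow> partial_latin_square n S (T ! r)"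
    and "\<And>r r'. r < \<mu> \<Longrightarrow> r' < \<mu> \<Longrightarrow> filled_cells (T ! r) = filled_cells (T ! r')"
    and "\<And>r r' i j. r < \<mu> \<Longrightarrow> r' < \<mu> \<Longrightarrow> r \<noteq> r' \<Longrightarrow> (i, j) \<in> filled_cells (T ! r) \<Longrightarrow>
      (T ! r) i j \<noteq> (T ! r') i j"
    and "\<And>r r' i. r < \<mu> \<Longrightarrow> r' < \<mu> \<Longrightarrow> row_symbols (T ! r) i = row_symbols (T ! r') i"
    and "\<And>r r' j. r < \<mu> \<Longrightarrow> r' < \<mu> \<Longrightarrow> col_symbols (T ! r) j = col_symbols (T ! r') j"
  shows "latin_trade \<mu> n S T"
  unfolding latin_trade_def
proof (intro conjI allI impI)
  fix r r' assume "r < \<mu>" "r' < \<mu>" "r \<noteq> r'"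
  then show "\<forall>(i, j) \<in> filled_cells (T ! r). (T ! r) i j \<noteq> (T ! r') i j"
    using assms(5) by blast
qed (rule assms; assumption)+

section \<open>Products of arrays\<close>

definition product_array :: "nat \<Rightarrow> 'a parray \<Rightarrow> 'b parray \<Rightarrow> ('a \<times> 'b) parray" where
  "product_array n P Q I J =
     (case (P (I div n) (J div n), Q (I mod n) (J mod n)) of
        (Some a, Some b) \<Rightarrow> Some (a, b)
      | _ \<Rightarrow> None)"

lemma product_array_eq_Some_iff:
  "product_array n P Q I J = Some s \<longleftrightarrow>
     P (I div n) (J div n) = Some (fst s) \<and> Q (I mod n) (J mod n) = Some (snd s)"
  by (cases s) (auto simp: product_array_def split: option.splits)

lemma filled_cells_product_iff:
  "(I, J) \<in> filled_cells (product_array n P Q) \<longleftrightarrow>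
     (I div n, J div n) \<in> filled_cells P \<and> (I mod n, J mod n) \<in> filled_cells Q"
  by (auto simp: filled_cells_def product_array_def split: option.splits)

lemma div_mod_eqI:
  fixes I J n :: nat
  shows "I div n = J div n \<Longrightarrow> I mod n = J mod n \<Longrightarrow> I = J"
  by (metis div_mult_mod_eq)

lemma card_div_mod:
  fixes A B :: "nat set"
  assumes "B \<subseteq> {..<n}"
  shows "card {I. I div n \<in> A \<and> I mod n \<in> B} = card A * card B"
proof -
  have "bij_betw (\<lambda>I. (I div n, I mod n)) {I. I div n \<in> A \<and> I mod n \<in> B} (A \<times> B)"
    by (rule bij_betw_byWitness[where f' = "\<lambda>(i, x). i * n + x"]) (use assms in auto)
  then show ?thesis
    by (simp add: bij_betw_same_card card_cartesian_product)
qed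

lemma card_div_mod_cells:
  fixes A B :: "(nat \<times> nat) set"
  assumes "B \<subseteq> {..<n} \<times> {..<n}"
  shows "card {(I, J). (I div n, J div n) \<in> A \<and> (I mod n, J mod n) \<in> B} = card A * card B"
proof -
  have "bij_betw (\<lambda>(I, J). ((I div n, J div n), (I mod n, J mod n)))
          {(I, J). (I div n, J div n) \<in> A \<and> (I mod n, J mod n) \<in> B} (A \<times> B)"
    by (rule bij_betw_byWitness[where f' = "\<lambda>((i, j), (x, y)). (i * n + x, j * n + y)"])
      (use assms in auto)
  then show ?thesis
    by (simp add: bij_betw_same_card card_cartesian_product)
qed

text \<open>
  Confining \<open>Q\<close> to the first \<open>n\<close> rows and columns ensures that each of its cells is the remainder
  of some cell of the product; otherwise some of the pairs on the right would be missed.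
\<close>

lemma row_symbols_product:
  assumes "filled_cells Q \<subseteq> {..<n} \<times> {..<n}"
  shows "row_symbols (product_array n P Q) I = row_symbols P (I div n) \<times> row_symbols Q (I mod n)"
proof (intro set_eqI iffI)
  fix s assume "s \<in> row_symbols P (I div n) \<times> row_symbols Q (I mod n)"
  then obtain j y where jy: "P (I div n) j = Some (fst s)" "Q (I mod n) y = Some (snd s)"
    by (auto simp: row_symbols_def)
  with assms have "y < n" by (auto simp: filled_cells_def)
  with jy have "product_array n P Q I (j * n + y) = Some s"
    by (simp add: product_array_eq_Some_iff)
  then show "s \<in> row_symbols (product_array n P Q) I"
    by (auto simp: row_symbols_def)
qed (auto simp: row_symbols_def product_array_eq_Some_iff)

lemma col_symbols_product:
  assumes "filled_cells Q \<subseteq> {..<n} \<times> {..<n}"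
  shows "col_symbols (product_array n P Q) J = col_symbols P (J div n) \<times> col_symbols Q (J mod n)"
proof (intro set_eqI iffI)
  fix s assume "s \<in> col_symbols P (J div n) \<times> col_symbols Q (J mod n)"
  then obtain i x where ix: "P i (J div n) = Some (fst s)" "Q x (J mod n) = Some (snd s)"
    by (auto simp: col_symbols_def)
  with assms have "x < n" by (auto simp: filled_cells_def)
  with ix have "product_array n P Q (i * n + x) J = Some s"
    by (simp add: product_array_eq_Some_iff)
  then show "s \<in> col_symbols (product_array n P Q) J"
    by (auto simp: col_symbols_def)
qed (auto simp: col_symbols_def product_array_eq_Some_iff)

lemma partial_latin_square_product:
  assumes P: "partial_latin_square m S P" and Q: "partial_latin_square n S' Q"
  shows "partial_latin_square (m * n) (S \<times> S') (product_array n P Q)"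
  unfolding partial_latin_square_def
proof (intro conjI allI impI)
  show "finite (S \<times> S')"
    using P Q by (auto simp: partial_latin_square_def)
  have bound: "I < m * n" if "I div n < m" "I mod n < n" for I
    using that by (metis div_less_iff_less_mult gr_implies_not_zero not_gr_zero)
  show "filled_cells (product_array n P Q) \<subseteq> {..<m * n} \<times> {..<m * n}"
  proof clarsimp
    fix I J assume "(I, J) \<in> filled_cells (product_array n P Q)"
    then have "(I div n, J div n) \<in> {..<m} \<times> {..<m}" "(I mod n, J mod n) \<in> {..<n} \<times> {..<n}"
      using P Q by (auto simp: partial_latin_square_def filled_cells_product_iff)
    then show "I < m * n \<and> J < m * n"
      by (auto intro!: bound)
  qed
next
  fix I J s assume "product_array n P Q I J = Some s"
  then show "s \<in> S \<times> S'"
    using partial_latin_squareD(3)[OF P] partial_latin_squareD(3)[OF Q]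
    by (auto simp: product_array_eq_Some_iff mem_Times_iff)
next
  fix I J J' s
  assume "product_array n P Q I J = Some s \<and> product_array n P Q I J' = Some s"
  then have "J div n = J' div n" "J mod n = J' mod n"
    using partial_latin_squareD(4)[OF P] partial_latin_squareD(4)[OF Q]
    unfolding product_array_eq_Some_iff by blast+
  then show "J = J'" by (rule div_mod_eqI)
next
  fix I I' J s
  assume "product_array n P Q I J = Some s \<and> product_array n P Q I' J = Some s"
  then have "I div n = I' div n" "I mod n = I' mod n"
    using partial_latin_squareD(5)[OF P] partial_latin_squareD(5)[OF Q]
    unfolding product_array_eq_Some_iff by blast+
  then show "I = I'" by (rule div_mod_eqI)
qed

section \<open>Products of trades\<close>

text \<open>
  The product array with index \<open>r\<close> belongs to the pair of indices \<open>(r div \<nu>, r mod \<nu>)\<close>, where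
  \<open>\<nu>\<close> is the length of the second trade, so that distinct indices differ in a component.
\<close>

definition product_trade :: "nat \<Rightarrow> 'a parray list \<Rightarrow> 'b parray list \<Rightarrow> ('a \<times> 'b) parray list" where
  "product_trade n T U =
     map (\<lambda>r. product_array n (T ! (r div length U)) (U ! (r mod length U)))
       [0..<length T * length U]"

lemma length_product_trade: "length (product_trade n T U) = length T * length U"
  by (simp add: product_trade_def)

lemma nth_product_trade:
  "r < length T * length U \<Longrightarrow>
     product_trade n T U ! r = product_array n (T ! (r div length U)) (U ! (r mod length U))"
  by (simp add: product_trade_def)

lemma div_less_mod_less:
  fixes r :: nat
  assumes "r < a * b"
  shows "r div b < a" "r mod b < b"
proof -
  have "b > 0" using assms by (cases b) auto
  then show "r div b < a" "r mod b < b"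
    using assms by (simp_all add: less_mult_imp_div_less)
qed

lemma latin_trade_product:
  assumes T: "latin_trade \<mu> m S T" and U: "latin_trade \<nu> n S' U"
  shows "latin_trade (\<mu> * \<nu>) (m * n) (S \<times> S') (product_trade n T U)"
proof -
  let ?V = "product_trade n T U"
  have len: "length T = \<mu>" "length U = \<nu>" and pos: "\<mu> * \<nu> > 0"
    using latin_tradeD(1,2)[OF T] latin_tradeD(1,2)[OF U] by simp_all
  have nth: "?V ! r = product_array n (T ! (r div \<nu>)) (U ! (r mod \<nu>))"
    and idx: "r div \<nu> < \<mu>" "r mod \<nu> < \<nu>" if "r < \<mu> * \<nu>" for r
    using that len nth_product_trade[of r T U n] div_less_mod_less[of r \<mu> \<nu>] by auto
  have U_cells: "filled_cells (U ! s) \<subseteq> {..<n} \<times> {..<n}" if "s < \<nu>" for s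
    by (rule partial_latin_squareD(2)[OF latin_tradeD(3)[OF U that]])
  have square: "partial_latin_square (m * n) (S \<times> S') (?V ! r)" if "r < \<mu> * \<nu>" for r
    unfolding nth[OF that]
    by (intro partial_latin_square_product latin_tradeD(3)[OF T] latin_tradeD(3)[OF U] idx that)
  have cells: "filled_cells (?V ! r) = filled_cells (?V ! r')"
    if r: "r < \<mu> * \<nu>" and r': "r' < \<mu> * \<nu>" for r r'
  proof -
    have "filled_cells (T ! (r div \<nu>)) = filled_cells (T ! (r' div \<nu>))"
      "filled_cells (U ! (r mod \<nu>)) = filled_cells (U ! (r' mod \<nu>))"
      by (rule latin_tradeD(4)[OF T] latin_tradeD(4)[OF U]; use idx r r' in simp)+
    then show ?thesis
      by (auto simp: nth r r' filled_cells_product_iff)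
  qed
  have entries: "(?V ! r) I J \<noteq> (?V ! r') I J"
    if r: "r < \<mu> * \<nu>" and r': "r' < \<mu> * \<nu>" and "r \<noteq> r'" and IJ: "(I, J) \<in> filled_cells (?V ! r)"
    for r r' I J
  proof
    assume eq: "(?V ! r) I J = (?V ! r') I J"
    obtain s where s: "(?V ! r) I J = Some s"
      using IJ by (auto simp: filled_cells_def)
    have "(T ! (r div \<nu>)) (I div n) (J div n) = (T ! (r' div \<nu>)) (I div n) (J div n)"
      "(U ! (r mod \<nu>)) (I mod n) (J mod n) = (U ! (r' mod \<nu>)) (I mod n) (J mod n)"
      using s s[unfolded eq] by (auto simp: nth r r' product_array_eq_Some_iff)
    moreover have "(I div n, J div n) \<in> filled_cells (T ! (r div \<nu>))"
      "(I mod n, J mod n) \<in> filled_cells (U ! (r mod \<nu>))"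
      using IJ by (auto simp: nth r filled_cells_product_iff)
    ultimately have "r div \<nu> = r' div \<nu>" "r mod \<nu> = r' mod \<nu>"
      using latin_tradeD(5)[OF T] latin_tradeD(5)[OF U] idx r r' by blast+
    then show False
      using \<open>r \<noteq> r'\<close> div_mod_eqI by blast
  qed
  have rows: "row_symbols (?V ! r) I = row_symbols (?V ! r') I"
    if r: "r < \<mu> * \<nu>" and r': "r' < \<mu> * \<nu>" for r r' I
  proof -
    have "row_symbols (T ! (r div \<nu>)) (I div n) = row_symbols (T ! (r' div \<nu>)) (I div n)"
      "row_symbols (U ! (r mod \<nu>)) (I mod n) = row_symbols (U ! (r' mod \<nu>)) (I mod n)"
      by (rule latin_tradeD(6)[OF T] latin_tradeD(6)[OF U]; use idx r r' in simp)+
    then show ?thesis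
      using idx r r' by (simp add: nth row_symbols_product U_cells)
  qed
  have cols: "col_symbols (?V ! r) J = col_symbols (?V ! r') J"
    if r: "r < \<mu> * \<nu>" and r': "r' < \<mu> * \<nu>" for r r' J
  proof -
    have "col_symbols (T ! (r div \<nu>)) (J div n) = col_symbols (T ! (r' div \<nu>)) (J div n)"
      "col_symbols (U ! (r mod \<nu>)) (J mod n) = col_symbols (U ! (r' mod \<nu>)) (J mod n)"
      by (rule latin_tradeD(7)[OF T] latin_tradeD(7)[OF U]; use idx r r' in simp)+
    then show ?thesis
      using idx r r' by (simp add: nth col_symbols_product U_cells)
  qed
  show ?thesis
    by (rule latin_tradeI[OF pos _ square cells entries rows cols])
      (simp_all add: length_product_trade len)
qed

lemma homogeneous_latin_trade_product:
  assumes T: "homogeneous_latin_trade \<mu> k m S T" and U: "homogeneous_latin_trade \<nu> l n S' U"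
  shows "homogeneous_latin_trade (\<mu> * \<nu>) (k * l) (m * n) (S \<times> S') (product_trade n T U)"
proof -
  let ?V = "product_trade n T U"
  have tT: "latin_trade \<mu> m S T" and tU: "latin_trade \<nu> n S' U"
    using T U by (auto simp: homogeneous_latin_trade_def)
  have counts:
    "(\<forall>I < m * n. card {J. (I, J) \<in> filled_cells (?V ! r)} = k * l) \<and>
     (\<forall>J < m * n. card {I. (I, J) \<in> filled_cells (?V ! r)} = k * l) \<and>
     (\<forall>s \<in> S \<times> S'. card {(I, J). (?V ! r) I J = Some s} = k * l)"
    if r: "r < \<mu> * \<nu>" for r
  proof -
    let ?P = "T ! (r div \<nu>)" and ?Q = "U ! (r mod \<nu>)"
    have idx: "r div \<nu> < \<mu>" "r mod \<nu> < \<nu>"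
      using r by (auto dest: div_less_mod_less)
    have nth: "?V ! r = product_array n ?P ?Q"
      using r nth_product_trade[of r T U n]
      by (simp add: latin_tradeD(2)[OF tT] latin_tradeD(2)[OF tU])
    have Q_cells: "filled_cells ?Q \<subseteq> {..<n} \<times> {..<n}"
      by (rule partial_latin_squareD(2)[OF latin_tradeD(3)[OF tU idx(2)]])
    have P_counts: "i < m \<Longrightarrow> card {j. (i, j) \<in> filled_cells ?P} = k"
      "j < m \<Longrightarrow> card {i. (i, j) \<in> filled_cells ?P} = k"
      "a \<in> S \<Longrightarrow> card {(i, j). ?P i j = Some a} = k" for i j a
      using T idx by (auto simp: homogeneous_latin_trade_def)
    have Q_counts: "i < n \<Longrightarrow> card {j. (i, j) \<in> filled_cells ?Q} = l"
      "j < n \<Longrightarrow> card {i. (i, j) \<in> filled_cells ?Q} = l"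
      "b \<in> S' \<Longrightarrow> card {(i, j). ?Q i j = Some b} = l" for i j b
      using U idx by (auto simp: homogeneous_latin_trade_def)
    show ?thesis
    proof (intro conjI allI impI ballI)
      fix I assume "I < m * n"
      then have I: "I div n < m" "I mod n < n" by (auto dest: div_less_mod_less)
      have "card {J. (I, J) \<in> filled_cells (?V ! r)} =
          card {j. (I div n, j) \<in> filled_cells ?P} * card {j. (I mod n, j) \<in> filled_cells ?Q}"
        using Q_cells by (subst card_div_mod[symmetric, where n = n])
          (auto simp: nth filled_cells_product_iff)
      then show "card {J. (I, J) \<in> filled_cells (?V ! r)} = k * l"
        using I by (simp add: P_counts Q_counts)
    next
      fix J assume "J < m * n"
      then have J: "J div n < m" "J mod n < n" by (auto dest: div_less_mod_less)
      have "card {I. (I, J) \<in> filled_cells (?V ! r)} =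
          card {i. (i, J div n) \<in> filled_cells ?P} * card {i. (i, J mod n) \<in> filled_cells ?Q}"
        using Q_cells by (subst card_div_mod[symmetric, where n = n])
          (auto simp: nth filled_cells_product_iff)
      then show "card {I. (I, J) \<in> filled_cells (?V ! r)} = k * l"
        using J by (simp add: P_counts Q_counts)
    next
      fix s assume s: "s \<in> S \<times> S'"
      have "card {(I, J). (?V ! r) I J = Some s} =
          card {(i, j). ?P i j = Some (fst s)} * card {(i, j). ?Q i j = Some (snd s)}"
        using Q_cells by (subst card_div_mod_cells[symmetric, where n = n])
          (auto simp: nth product_array_eq_Some_iff filled_cells_def)
      then show "card {(I, J). (?V ! r) I J = Some s} = k * l"
        using s by (auto simp: P_counts Q_counts)
    qed
  qed
  then show ?thesis
    using T U latin_trade_product[OF tT tU]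
    by (auto simp: homogeneous_latin_trade_def card_cartesian_product mult_le_mono)
qed

section \<open>Relabelling the symbols\<close>

definition relabel :: "('a \<Rightarrow> 'b) \<Rightarrow> 'a parray \<Rightarrow> 'b parray" where
  "relabel f P i j = map_option f (P i j)"

lemma filled_cells_relabel: "filled_cells (relabel f P) = filled_cells P"
  by (auto simp: filled_cells_def relabel_def)

lemma row_symbols_relabel: "row_symbols (relabel f P) i = f ` row_symbols P i"
  by (auto simp: row_symbols_def relabel_def)

lemma col_symbols_relabel: "col_symbols (relabel f P) j = f ` col_symbols P j"
  by (auto simp: col_symbols_def relabel_def)

text \<open>
  All entries lie in \<open>S\<close>, so injectivity on \<open>S\<close> lets the Latin property, the disagreement of the
  arrays of a trade and the symbol counts be read off from the original entries.
\<close>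

lemma relabel_eq_Some_iff:
  assumes "inj_on f S" "partial_latin_square n S P" "s \<in> S"
  shows "relabel f P i j = Some (f s) \<longleftrightarrow> P i j = Some s"
  using assms by (auto simp: relabel_def partial_latin_square_def dest: inj_onD)

lemma partial_latin_square_relabel:
  assumes f: "inj_on f S" and P: "partial_latin_square n S P"
  shows "partial_latin_square n (f ` S) (relabel f P)"
proof -
  have entry: "\<exists>s \<in> S. t = f s \<and> P i j = Some s" if "relabel f P i j = Some t" for i j t
    using that P by (auto simp: relabel_def partial_latin_square_def)
  have "j = j'" if "relabel f P i j = Some t" "relabel f P i j' = Some t" for i j j' t
    using entry[OF that(1)] that(2) relabel_eq_Some_iff[OF f P]
      partial_latin_squareD(4)[OF P]
    by metis
  moreover have "i = i'" if "relabel f P i j = Some t" "relabel f P i' j = Some t" for i i' j t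
    using entry[OF that(1)] that(2) relabel_eq_Some_iff[OF f P]
      partial_latin_squareD(5)[OF P]
    by metis
  ultimately show ?thesis
    using partial_latin_squareD(1,2)[OF P] entry
    unfolding partial_latin_square_def filled_cells_relabel by blast
qed

lemma latin_trade_relabel:
  assumes f: "inj_on f S" and T: "latin_trade \<mu> n S T"
  shows "latin_trade \<mu> n (f ` S) (map (relabel f) T)"
proof -
  have P: "partial_latin_square n S (T ! r)" if "r < \<mu>" for r
    by (rule latin_tradeD(3)[OF T that])
  have entries: "relabel f (T ! r) i j \<noteq> relabel f (T ! r') i j"
    if r: "r < \<mu>" and r': "r' < \<mu>" and "r \<noteq> r'" and ij: "(i, j) \<in> filled_cells (T ! r)" for r r' i j
  proof
    assume eq: "relabel f (T ! r) i j = relabel f (T ! r') i j"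
    from ij obtain s where s: "(T ! r) i j = Some s"
      by (auto simp: filled_cells_def)
    then have "s \<in> S"
      using P[OF r] by (auto simp: partial_latin_square_def)
    then have "(T ! r') i j = Some s"
      using s eq relabel_eq_Some_iff[OF f P] r r' by metis
    then show False
      using s latin_tradeD(5)[OF T r r' ij] \<open>r \<noteq> r'\<close> by simp
  qed
  have len: "length T = \<mu>"
    by (rule latin_tradeD(2)[OF T])
  show ?thesis
  proof (rule latin_tradeI)
    fix r assume r: "r < \<mu>"
    show "partial_latin_square n (f ` S) (map (relabel f) T ! r)"
      using partial_latin_square_relabel[OF f P[OF r]] r len by simp
    fix r' assume r': "r' < \<mu>"
    show "filled_cells (map (relabel f) T ! r) = filled_cells (map (relabel f) T ! r')"
      using latin_tradeD(4)[OF T r r'] r r' len by (simp add: filled_cells_relabel)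
    show "row_symbols (map (relabel f) T ! r) i = row_symbols (map (relabel f) T ! r') i" for i
      using latin_tradeD(6)[OF T r r'] r r' len by (simp add: row_symbols_relabel)
    show "col_symbols (map (relabel f) T ! r) j = col_symbols (map (relabel f) T ! r') j" for j
      using latin_tradeD(7)[OF T r r'] r r' len by (simp add: col_symbols_relabel)
    show "(map (relabel f) T ! r) i j \<noteq> (map (relabel f) T ! r') i j"
      if "r \<noteq> r'" "(i, j) \<in> filled_cells (map (relabel f) T ! r)" for i j
      using entries[OF r r' that(1)] that(2) r r' len by (simp add: filled_cells_relabel)
  qed (use latin_tradeD(1)[OF T] len in simp_all)
qed

lemma homogeneous_latin_trade_relabel:
  assumes f: "inj_on f S" and T: "homogeneous_latin_trade \<mu> k m S T"
  shows "homogeneous_latin_trade \<mu> k m (f ` S) (map (relabel f) T)"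
proof -
  have t: "latin_trade \<mu> m S T"
    using T by (simp add: homogeneous_latin_trade_def)
  have P: "partial_latin_square m S (T ! r)" if "r < \<mu>" for r
    by (rule latin_tradeD(3)[OF t that])
  have nth: "map (relabel f) T ! r = relabel f (T ! r)" if "r < \<mu>" for r
    using that latin_tradeD(2)[OF t] by simp
  have count: "card {(i, j). relabel f (T ! r) i j = Some (f s)} = k" if "r < \<mu>" "s \<in> S" for r s
    using T that by (simp add: relabel_eq_Some_iff[OF f P] homogeneous_latin_trade_def)
  show ?thesis
    using T latin_trade_relabel[OF f t] count
    by (simp add: homogeneous_latin_trade_def nth card_image[OF f] filled_cells_relabel)
qed

section \<open>The product theorem\<close>

theorem theorem6:
  fixes \<mu>1 k1 m1 \<mu>2 k2 m2 :: nat
  assumes "\<mu>1 > 0" "k1 > 0" "m1 > 0" "\<mu>2 > 0" "k2 > 0" "m2 > 0"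
    and "m1 \<ge> k1" "m2 \<ge> k2"
    and "\<exists>(S :: 'a set) T. homogeneous_latin_trade \<mu>1 k1 m1 S T"
    and "\<exists>(S :: 'b set) T. homogeneous_latin_trade \<mu>2 k2 m2 S T"
  shows "\<exists>(S :: nat set) T. homogeneous_latin_trade (\<mu>1 * \<mu>2) (k1 * k2) (m1 * m2) S T"
proof -
  obtain S1 :: "'a set" and T1 where T1: "homogeneous_latin_trade \<mu>1 k1 m1 S1 T1"
    using assms by blast
  obtain S2 :: "'b set" and T2 where T2: "homogeneous_latin_trade \<mu>2 k2 m2 S2 T2"
    using assms by blast
  note V = homogeneous_latin_trade_product[OF T1 T2]
  then have "latin_trade (\<mu>1 * \<mu>2) (m1 * m2) (S1 \<times> S2) (product_trade m2 T1 T2)"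
    by (simp add: homogeneous_latin_trade_def)
  then have "finite (S1 \<times> S2)"
    using latin_tradeD(1,3) partial_latin_squareD(1) by blast
  then obtain f :: "'a \<times> 'b \<Rightarrow> nat" where "inj_on f (S1 \<times> S2)"
    using finite_imp_inj_to_nat_seg by blast
  then show ?thesis
    using homogeneous_latin_trade_relabel[OF _ V] by blast
qed

end
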